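(* Let $G=(V,E)$ be a directed graph with leader set $V_L\subseteq V$ and target set $V_T\subseteq V$, and let $D(V_L)$ be the derived set of $V_L$ in $G$. Let $V_T\setminus D(V_L)$ be partitioned according to distance from $D(V_L)$ as $$V_T\setminus D(V_L)=V_1\cup V_2\cup\dots\cup V_d,$$ where, for $j\in V_T\setminus D(V_L)$ and $i=1,\dots,d$, one has $j\in V_i$ if and only if $d(D(V_L),j)=i$. For each $i=1,\dots,d$ let $G_i=(D(V_L),V_i,E_i)$ be the bipartite graph in which, for $j\in D(V_L)$ and $k\in V_i$, $(j,k)\in E_i$ if and only if $d(j,k)=i$ in $G$. Assume that $D(V_L)$ is a zero forcing set in $G_i$ for every $i=1,2,\dots,d$. Then $(G;V_L;V_T)$ is targeted controllable with respect to $\mathcal{Q}_d(G)$.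
   Context: All graphs are finite, simple, directed and without self-loops; $V=\{1,\dots,n\}$. Distance: $d(u,v)$ is the length of a shortest directed path from $u$ to $v$ in $G$ ($\infty$ if there is none, $0$ if $u=v$). For nonempty $S\subseteq V$, $d(S,j)=\min_{i\in S}d(i,j)$. (In particular, the existence of the partition in the claim means that every vertex of $V_T\setminus D(V_L)$ is at finite distance from $D(V_L)$.) Bipartite graphs: $G=(V^-,V^+,E)$ denotes a directed graph whose vertex set is the disjoint union of $V^-$ and $V^+$ and all of whose arcs go from $V^-$ to $V^+$. Zero forcing: given a directed graph whose vertices are colored black or white, the color-change rule is: if $u$ is black and exactly one out-neighbour $v$ of $u$ is white, then change the color of $v$ to black. For a set $C$ of vertices, color $C$ black and all other vertices white; the derived set $D(C)$ is the set of black vertices obtained by applying the rule until no more changes are possible. A set $Z$ is a zero forcing set if $D(Z)$ is the whole vertex set. Qualitative class: $\mathcal{Q}(G)=\{X\in\mathbb{R}^{n\times n} : \text{for } i\neq j,\ X_{ij}\neq 0\iff (j,i)\in E\}$ (diagonal entries are arbitrary). A matrix $X\in\mathcal{Q}(G)$ is distance-information preserving if for any two distinct vertices $i,j\in V$, $d(j,i)=k$ (with $k$ finite) implies $(X^k)_{ij}\neq0$. $\mathcal{Q}_d(G)\subseteq\mathcal{Q}(G)$ is the set of all distance-information preserving matrices in $\mathcal{Q}(G)$. Target control: for $V'=\{v_1,\dots,v_r\}\subseteq V$, $P(V;V')$ is the $n\times r$ matrix with $P_{ij}=1$ if $i=v_j$ and $P_{ij}=0$ otherwise. Put $U=P(V;V_L)$,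 $H=P^T(V;V_T)$, $p=|V_T|$. For a class $\mathcal{Q}_s(G)\subseteq\mathcal{Q}(G)$, $(G;V_L;V_T)$ is targeted controllable with respect to $\mathcal{Q}_s(G)$ if for every $X\in\mathcal{Q}_s(G)$ the system $\dot x=Xx+Uu$, $y=Hx$ is output controllable, i.e. $\operatorname{rank}\begin{pmatrix}HU&HXU&\cdots&HX^{n-1}U\end{pmatrix}=p$. *)

theory Defs
  imports
    "Graph_Theory.Pair_Digraph"
    "Jordan_Normal_Form.DL_Rank"
    "HOL-Library.Extended_Nat"
begin

text \<open>The infimum of the empty set of type \<^typ>\<open>enat\<close> is \<open>\<infinity>\<close>, so unreachable vertices are at
  distance \<open>\<infinity>\<close>.\<close>

definition gdist :: "'a pair_pre_digraph \<Rightarrow> 'a \<Rightarrow> 'a \<Rightarrow> enat" where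
  "gdist G u v = (INF p \<in> {p. pre_digraph.apath (with_proj G) u p v}. enat (length p))"

definition gdist_set :: "'a pair_pre_digraph \<Rightarrow> 'a set \<Rightarrow> 'a \<Rightarrow> enat" where
  "gdist_set G S v = (INF u \<in> S. gdist G u v)"

definition color_change :: "'a pair_pre_digraph \<Rightarrow> 'a set \<Rightarrow> 'a set \<Rightarrow> bool" where
  "color_change G B B' \<longleftrightarrow>
     (\<exists>u\<in>B. \<exists>v. {w. (u, w) \<in> parcs G \<and> w \<notin> B} = {v} \<and> B' = insert v B)"

definition derived_set :: "'a pair_pre_digraph \<Rightarrow> 'a set \<Rightarrow> 'a set" where
  "derived_set G C = (THE B. (color_change G)\<^sup>*\<^sup>* C B \<and> (\<nexists>B'. color_change G B B'))"

definition zero_forcing_set :: "'a pair_pre_digraph \<Rightarrow> 'a set \<Rightarrow> bool" where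
  "zero_forcing_set G Z \<longleftrightarrow> Z \<subseteq> pverts G \<and> derived_set G Z = pverts G"

text \<open>The description used in \<^const>\<open>derived_set\<close> determines a unique set: the colouring process
  stops on every finite digraph and its outcome does not depend on the order of the changes.\<close>

lemma color_change_le_final:
  assumes "(color_change G)\<^sup>*\<^sup>* C B" "(color_change G)\<^sup>*\<^sup>* C D" "\<nexists>B'. color_change G D B'"
  shows "B \<subseteq> D"
  using assms(1)
proof (induction rule: rtranclp_induct)
  case base
  show ?case
    using assms(2) by (induction rule: rtranclp_induct) (auto simp: color_change_def)
next
  case (step A B)
  then obtain u v where uv: "u \<in> A" "{w. (u, w) \<in> parcs G \<and> w \<notin> A} = {v}" "B = insert v A"
    by (auto simp: color_change_def)
  have "v \<in> D"
  proof (rule ccontr)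
    assume "v \<notin> D"
    then have "{w. (u, w) \<in> parcs G \<and> w \<notin> D} = {v}"
      using uv(2) step.IH by blast
    then have "color_change G D (insert v D)"
      using uv(1) step.IH by (auto simp: color_change_def)
    then show False
      using assms(3) by blast
  qed
  then show ?case
    using uv(3) step.IH by blast
qed

lemma (in pair_fin_digraph) derived_set_ex1:
  assumes "C \<subseteq> pverts G"
  shows "\<exists>!B. (color_change G)\<^sup>*\<^sup>* C B \<and> (\<nexists>B'. color_change G B B')"
proof (rule ex_ex1I)
  show "\<exists>B. (color_change G)\<^sup>*\<^sup>* C B \<and> (\<nexists>B'. color_change G B B')"
    using assms
  proof (induction "card (pverts G - C)" arbitrary: C rule: less_induct)
    case less
    show ?case
    proof (cases "\<exists>B'. color_change G C B'")
      case False
      then show ?thesis by blast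
    next
      case True
      then obtain u v where uv: "u \<in> C" "{w. (u, w) \<in> parcs G \<and> w \<notin> C} = {v}"
        and cc: "color_change G C (insert v C)"
        by (auto simp: color_change_def)
      from uv(2) have v: "v \<in> pverts G" "v \<notin> C"
        using in_arcsD2 by auto
      then have "card (pverts G - insert v C) < card (pverts G - C)"
        using pair_finite_verts by (intro psubset_card_mono) auto
      moreover have "insert v C \<subseteq> pverts G"
        using less.prems v by simp
      ultimately obtain B where
        "(color_change G)\<^sup>*\<^sup>* (insert v C) B" "\<nexists>B'. color_change G B B'"
        using less.hyps by blast
      then show ?thesis
        using cc by (meson converse_rtranclp_into_rtranclp)
    qed
  qed
next
  fix B B'
  assume "(color_change G)\<^sup>*\<^sup>* C B \<and> (\<nexists>A. color_change G B A)"
    and "(color_change G)\<^sup>*\<^sup>* C B' \<and> (\<nexists>A. color_change G B' A)"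
  then show "B = B'"
    by (meson color_change_le_final subset_antisym)
qed

text \<open>The vertices of a graph of order \<open>n\<close> are \<open>0, \<dots>, n - 1\<close>, the index range
  of its matrices. The entry at \<open>(i, j)\<close> belongs to the arc from \<open>j\<close> to \<open>i\<close>.\<close>

definition qual_class :: "nat pair_pre_digraph \<Rightarrow> real mat set" where
  "qual_class G =
     {X \<in> carrier_mat (card (pverts G)) (card (pverts G)).
        \<forall>i\<in>pverts G. \<forall>j\<in>pverts G. i \<noteq> j \<longrightarrow> (X $$ (i, j) \<noteq> 0 \<longleftrightarrow> (j, i) \<in> parcs G)}"

definition distance_info_preserving :: "nat pair_pre_digraph \<Rightarrow> real mat \<Rightarrow> bool" where
  "distance_info_preserving G X \<longleftrightarrow>
     (\<forall>i\<in>pverts G. \<forall>j\<in>pverts G. \<forall>k.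
        i \<noteq> j \<longrightarrow> gdist G j i = enat k \<longrightarrow> (X ^\<^sub>m k) $$ (i, j) \<noteq> 0)"

definition qual_class_d :: "nat pair_pre_digraph \<Rightarrow> real mat set" where
  "qual_class_d G = {X \<in> qual_class G. distance_info_preserving G X}"

text \<open>The columns are indexed by \<open>S\<close> in increasing order.\<close>

definition sel_mat :: "nat \<Rightarrow> nat set \<Rightarrow> real mat" where
  "sel_mat n S =
     mat n (card S) (\<lambda>(i, j). if i = sorted_list_of_set S ! j then 1 else 0)"

text \<open>The block matrix \<open>(H U, H X U, \<dots>, H X\<^bsup>n-1\<^esup> U)\<close>, where \<open>n\<close> is the order of \<open>X\<close>.\<close>

definition output_ctrb_mat :: "real mat \<Rightarrow> real mat \<Rightarrow> real mat \<Rightarrow> real mat" where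
  "output_ctrb_mat X U H =
     mat_of_cols (dim_row H) (concat (map (\<lambda>k. cols (H * X ^\<^sub>m k * U)) [0..<dim_row X]))"

definition output_controllable :: "real mat \<Rightarrow> real mat \<Rightarrow> real mat \<Rightarrow> bool" where
  "output_controllable X U H \<longleftrightarrow>
     vec_space.rank (dim_row H) (output_ctrb_mat X U H) = dim_row H"

definition targeted_controllable ::
  "nat pair_pre_digraph \<Rightarrow> nat set \<Rightarrow> nat set \<Rightarrow> real mat set \<Rightarrow> bool" where
  "targeted_controllable G VL VT Qs \<longleftrightarrow>
     (\<forall>X\<in>Qs. output_controllable X (sel_mat (card (pverts G)) VL)
                (transpose_mat (sel_mat (card (pverts G)) VT)))"

text \<open>The layer \<open>W\<close> is always disjoint from \<open>D\<close>, so the disjoint union of vertex sets is \<open>D \<union> W\<close>.\<close>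

definition layer_graph ::
  "'a pair_pre_digraph \<Rightarrow> 'a set \<Rightarrow> nat \<Rightarrow> 'a set \<Rightarrow> 'a pair_pre_digraph" where
  "layer_graph G D i W =
     \<lparr> pverts = D \<union> W, parcs = {(j, k). j \<in> D \<and> k \<in> W \<and> gdist G j k = enat i} \<rparr>"

end

theory Submission
  imports Defs
begin

text \<open>Suppose a row vector \<open>\<eta>\<close> supported on \<open>V\<^sub>T\<close> annihilates \<open>X\<^bsup>k\<^esup> e\<^sub>j\<close> for all \<open>j \<in> V\<^sub>L\<close> and all
  \<open>k < n\<close>, hence for all \<open>k\<close>. Reading column \<open>u\<close> of \<open>\<eta> X\<^bsup>k+1\<^esup>\<close> shows that a force \<open>u \<rightarrow> v\<close> in \<open>G\<close>
  propagates \<open>\<eta> X\<^bsup>k\<^esup> e\<^sub>v = 0\<close> (for all \<open>k\<close>) to \<open>v\<close>, so it holds on all of \<open>D(V\<^sub>L)\<close>. In particular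
  \<open>\<eta>\<close> vanishes on \<open>D(V\<^sub>L)\<close>. If it also vanishes on \<open>V\<^sub>1, \<dots>, V\<^sub>i\<^sub>-\<^sub>1\<close>, then in the equation
  \<open>\<eta> X\<^bsup>i\<^esup> e\<^sub>u = 0\<close> with \<open>u \<in> D(V\<^sub>L)\<close> only the out-neighbours of \<open>u\<close> in \<open>G\<^sub>i\<close> contribute: farther
  targets have entry \<open>0\<close> in \<open>X\<^bsup>i\<^esup>\<close>. So each force in \<open>G\<^sub>i\<close> gives one more zero of \<open>\<eta>\<close> on \<open>V\<^sub>i\<close>.\<close>

section \<open>Linear algebra: full row rank and linear recurrences\<close>

text \<open>Zero rows pad the vectors to a square matrix; its determinant vanishes, so its kernel is
  nontrivial.\<close>

lemma ex_nonzero_orthogonal_vec: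
  fixes ws :: "'a::field vec list"
  assumes ws: "set ws \<subseteq> carrier_vec n" and len: "length ws < n"
  obtains z where "z \<in> carrier_vec n" "z \<noteq> 0\<^sub>v n" "\<And>w. w \<in> set ws \<Longrightarrow> w \<bullet> z = 0"
proof -
  \<comment> \<open>The row at index \<open>length ws\<close> is singled out so that the term has
    the shape of \<open>det_row_0\<close>.\<close>
  define A where
    "A = mat\<^sub>r n n (\<lambda>i. if i = length ws then 0\<^sub>v n else if i < length ws then ws ! i else 0\<^sub>v n)"
  have A: "A \<in> carrier_mat n n"
    by (simp add: A_def)
  have "(\<lambda>i. if i < length ws then ws ! i else 0\<^sub>v n) \<in> {0..<n} \<rightarrow> carrier_vec n"
    using ws by (auto intro: subsetD[OF ws nth_mem])
  then have "det A = 0"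
    unfolding A_def by (rule det_row_0[OF len])
  then obtain z where z: "z \<in> carrier_vec n" "z \<noteq> 0\<^sub>v n" "A *\<^sub>v z = 0\<^sub>v n"
    using det_0_iff_vec_prod_zero_field[OF A] by blast
  have "w \<bullet> z = 0" if w: "w \<in> set ws" for w
  proof -
    obtain i where i: "i < length ws" "w = ws ! i"
      using w by (metis in_set_conv_nth)
    have "(A *\<^sub>v z) $ i = row A i \<bullet> z"
      using A i len by simp
    moreover have "row A i = w"
      using i len subsetD[OF ws w] unfolding A_def by (subst row_mat_of_row_fun) auto
    ultimately show ?thesis
      using z(3) i len by simp
  qed
  then show thesis
    using that z by blast
qed

text \<open>A maximal independent set \<open>S\<close> of columns spans all columns, and its size is
  the rank. With fewer than \<open>n\<close> elements it would leave a nonzero vector orthogonal to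
  every column.\<close>

lemma (in vec_space) rank_eq_dim_row_if_orthogonal_trivial:
  assumes A: "A \<in> carrier_mat n nc"
    and triv: "\<And>z. z \<in> carrier_vec n \<Longrightarrow> \<forall>c\<in>set (cols A). z \<bullet> c = 0 \<Longrightarrow> z = 0\<^sub>v n"
  shows "rank A = n"
proof -
  have C: "set (cols A) \<subseteq> carrier_vec n"
    using A cols_dim by blast
  have "lin_indpt {}"
    by (simp add: lin_dep_def)
  then obtain S where S: "maximal S (\<lambda>T. T \<subseteq> set (cols A) \<and> lin_indpt T)"
    using maximal_exists_superset[of "set (cols A)" "\<lambda>T. T \<subseteq> set (cols A) \<and> lin_indpt T" "{}"]
    by auto
  then have S_sub: "S \<subseteq> set (cols A)" and S_li: "lin_indpt S"
    by (auto simp: maximal_def)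
  have S_car: "S \<subseteq> carrier_vec n"
    using S_sub C by blast
  have span: "set (cols A) \<subseteq> span S"
  proof
    fix c assume c: "c \<in> set (cols A)"
    show "c \<in> span S"
    proof (rule ccontr)
      assume nspan: "c \<notin> span S"
      then have "c \<notin> S"
        using in_own_span[OF S_car] by blast
      moreover have "lin_indpt (S \<union> {c})"
        using lin_dep_iff_in_span[of S c] nspan \<open>c \<notin> S\<close> S_car S_li c C by auto
      ultimately show False
        using S c S_sub unfolding maximal_def by blast
    qed
  qed
  have fin: "finite S" and le: "card S \<le> n"
    using li_le_dim[OF fin_dim] S_car S_li dim_is_n by auto
  have "\<not> card S < n"
  proof
    assume lt: "card S < n"
    obtain ws where ws: "set ws = S" "distinct ws"
      using finite_distinct_list[OF fin] by blast
    obtain z where z: "z \<in> carrier_vec n" "z \<noteq> 0\<^sub>v n" "\<And>w. w \<in> S \<Longrightarrow> w \<bullet> z = 0"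
      using ex_nonzero_orthogonal_vec[of ws n] ws S_car lt distinct_card[of ws] by metis
    have "z \<in> orthogonal_complement S"
      unfolding orthogonal_complement_def
      proof (intro CollectI conjI ballI)
      fix y assume "y \<in> S"
      then show "z \<bullet> y = 0"
        using z S_car by (metis comm_scalar_prod subset_eq)
    qed (rule z)
    then have "z \<in> orthogonal_complement (span S)"
      using S_car by simp
    then have "\<forall>c\<in>set (cols A). z \<bullet> c = 0"
      using span unfolding orthogonal_complement_def by blast
    then show False
      using triv z by blast
  qed
  then show ?thesis
    using rank_card_indpt[OF A S] le by simp
qed

text \<open>A stand-in for the Cayley--Hamilton theorem: \<open>n + 1\<close> consecutive terms of the sequence of row
  vectors \<open>s 0, s 1, \<dots>\<close> are linearly dependent, with coefficients that serve every shift.\<close>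

lemma linear_recurrence_vanishes:
  fixes s :: "nat \<Rightarrow> nat \<Rightarrow> 'a::field"
  assumes rec: "\<And>k j. j < n \<Longrightarrow> s (Suc k) j = (\<Sum>l<n. s k l * M l j)"
    and j: "j < n"
    and init: "\<And>k. k < n \<Longrightarrow> s k j = 0"
  shows "s k j = 0"
proof -
  \<comment> \<open>Vector \<open>i\<close> lists the first \<open>n + 1\<close> terms of coordinate
    \<open>i\<close>. These are \<open>n\<close> vectors in dimension \<open>n + 1\<close>, so a
    nonzero \<open>z\<close> is orthogonal to all of them: the coefficients of the
    dependence.\<close>
  define ws where "ws = map (\<lambda>i. vec (Suc n) (\<lambda>k. s k i)) [0..<n]"
  obtain z where z: "z \<in> carrier_vec (Suc n)" "z \<noteq> 0\<^sub>v (Suc n)" "\<And>w. w \<in> set ws \<Longrightarrow> w \<bullet> z = 0"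
    by (rule ex_nonzero_orthogonal_vec[of ws "Suc n"]) (auto simp: ws_def)
  define K where "K = {k. k \<le> n \<and> z $ k \<noteq> 0}"
  have "K \<noteq> {}"
    using z(1,2) by (auto simp: K_def vec_eq_iff less_Suc_eq_le)
  \<comment> \<open>The last nonzero coefficient: the relation can be solved for its top
    term.\<close>
  define m where "m = Max K"
  have "finite K"
    by (simp add: K_def)
  then have "m \<in> K" and max: "\<And>k. k \<in> K \<Longrightarrow> k \<le> m"
    using \<open>K \<noteq> {}\<close> by (auto simp: m_def)
  then have m: "m \<le> n" "z $ m \<noteq> 0"
    by (auto simp: K_def)
  \<comment> \<open>Multiplication by \<open>M\<close> carries the relation from shift
    \<open>q\<close> to \<open>Suc q\<close>. It mixes the coordinates, hence the claim for all
    \<open>i\<close> at once.\<close>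
  have dep: "(\<Sum>k\<le>m. z $ k * s (q + k) i) = 0" if "i < n" for q i
    using that
  proof (induction q arbitrary: i)
    case 0
    have "vec (Suc n) (\<lambda>k. s k i) \<bullet> z = 0"
      using 0 by (intro z(3)) (auto simp: ws_def)
    then have "(\<Sum>k\<le>n. z $ k * s k i) = 0"
      using z(1) by (simp add: scalar_prod_def atLeast0LessThan lessThan_Suc_atMost mult.commute)
    moreover have "(\<Sum>k\<le>n. z $ k * s k i) = (\<Sum>k\<le>m. z $ k * s k i)"
      using m max by (intro sum.mono_neutral_right) (auto simp: K_def)
    ultimately show ?case
      by simp
  next
    case (Suc q)
    have "(\<Sum>k\<le>m. z $ k * s (Suc q + k) i) = (\<Sum>k\<le>m. \<Sum>l<n. z $ k * s (q + k) l * M l i)"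
      using Suc.prems by (simp add: rec sum_distrib_left mult.assoc)
    also have "\<dots> = (\<Sum>l<n. (\<Sum>k\<le>m. z $ k * s (q + k) l) * M l i)"
      by (subst sum.swap) (simp add: sum_distrib_right)
    also have "\<dots> = 0"
      using Suc.IH by simp
    finally show ?case .
  qed
  show ?thesis
  proof (induction k rule: less_induct)
    case (less k)
    show ?case
    proof (cases "k < n")
      case True
      then show ?thesis by (rule init)
    next
      case False
      then have mk: "m \<le> k"
        using m by simp
      have "0 = (\<Sum>i\<le>m. z $ i * s (k - m + i) j)"
        using dep[OF j] by simp
      also have "\<dots> = (\<Sum>i<m. z $ i * s (k - m + i) j) + z $ m * s k j"
        using mk by (simp add: lessThan_Suc_atMost[symmetric])
      also have "(\<Sum>i<m. z $ i * s (k - m + i) j) = 0"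
        using mk by (intro sum.neutral ballI) (simp add: less)
      finally show ?thesis
        using m by simp
    qed
  qed
qed

section \<open>Output controllability in terms of row vectors\<close>

lemma index_sel_mat_mult:
  assumes M: "M \<in> carrier_mat n n" and S: "S \<subseteq> {..<n}" and T: "T \<subseteq> {..<n}"
    and a: "a < card T" and b: "b < card S"
  shows "(transpose_mat (sel_mat n T) * M * sel_mat n S) $$ (a, b) =
    M $$ (sorted_list_of_set T ! a, sorted_list_of_set S ! b)"
proof -
  have fin: "finite S" "finite T"
    using S T finite_subset by auto
  define t where "t = sorted_list_of_set T ! a"
  define s where "s = sorted_list_of_set S ! b"
  have "t \<in> T" "s \<in> S"
    using a b fin unfolding t_def s_def by (metis length_sorted_list_of_set nth_mem set_sorted_list_of_set)+
  then have ts: "t < n" "s < n"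
    using S T by auto
  have "col (sel_mat n T) a = unit_vec n t" "col (sel_mat n S) b = unit_vec n s"
    using a b by (auto simp: sel_mat_def t_def s_def unit_vec_def)
  moreover have "(transpose_mat (sel_mat n T) * M * sel_mat n S) $$ (a, b) =
      (transpose_mat (sel_mat n T) * (M * sel_mat n S)) $$ (a, b)"
    using M by (subst assoc_mult_mat[of _ "card T" n _ n _ "card S"]) (auto simp: sel_mat_def)
  moreover have "\<dots> = col (sel_mat n T) a \<bullet> col (M * sel_mat n S) b"
    using a b M by (simp add: sel_mat_def)
  moreover have "col (M * sel_mat n S) b = M *\<^sub>v col (sel_mat n S) b"
    using M b by (intro col_mult2[of _ n n _ "card S"]) (auto simp: sel_mat_def)
  ultimately show ?thesis
    using ts M by (simp add: t_def[symmetric] s_def[symmetric])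
qed

text \<open>Full row rank is tested on vectors \<open>z\<close> orthogonal to all columns.
  Relabelling \<open>z\<close> along the enumeration of \<open>VT\<close> gives an \<eta> indexed by
  target vertices instead of row positions.\<close>

lemma output_controllable_sel_matI:
  assumes X: "X \<in> carrier_mat n n" and VL: "VL \<subseteq> {..<n}" and VT: "VT \<subseteq> {..<n}"
    and triv: "\<And>\<eta> i. \<forall>k<n. \<forall>j\<in>VL. (\<Sum>i\<in>VT. \<eta> i * (X ^\<^sub>m k) $$ (i, j)) = 0 \<Longrightarrow> i \<in> VT \<Longrightarrow> \<eta> i = 0"
  shows "output_controllable X (sel_mat n VL) (transpose_mat (sel_mat n VT))"
proof -
  let ?U = "sel_mat n VL" and ?H = "transpose_mat (sel_mat n VT)"
  let ?O = "output_ctrb_mat X ?U ?H"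
  define p where "p = card VT"
  define t where "t = (!) (sorted_list_of_set VT)"
  have fin: "finite VL" "finite VT"
    using VL VT finite_subset by auto
  have t: "bij_betw t {..<p} VT"
    unfolding t_def p_def using fin by (intro bij_betw_nth) auto
  have p: "dim_row ?H = p"
    by (simp add: sel_mat_def p_def)
  have O: "?O \<in> carrier_mat p (dim_col ?O)"
    using p by (auto simp: output_ctrb_mat_def)
  have "vec_space.rank p ?O = p"
  proof (rule vec_space.rank_eq_dim_row_if_orthogonal_trivial[OF O])
    fix z :: "real vec"
    assume z: "z \<in> carrier_vec p" and orth: "\<forall>c\<in>set (cols ?O). z \<bullet> c = 0"
    define \<eta> where "\<eta> i = z $ (inv_into {..<p} t i)" for i
    have \<eta>: "\<eta> (t a) = z $ a" if "a < p" for a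
      using that t by (simp add: \<eta>_def bij_betw_inv_into_left)
    have "(\<Sum>i\<in>VT. \<eta> i * (X ^\<^sub>m k) $$ (i, j)) = 0" if k: "k < n" and j: "j \<in> VL" for k j
    proof -
      let ?B = "?H * X ^\<^sub>m k * ?U"
      obtain b where b: "b < card VL" "j = sorted_list_of_set VL ! b"
        using j fin by (metis in_set_conv_nth length_sorted_list_of_set set_sorted_list_of_set)
      have B: "?B \<in> carrier_mat p (card VL)"
        using X by (auto simp: sel_mat_def p_def)
      have "col ?B b \<in> set (cols ?B)"
        using B b by (metis carrier_matD(2) cols_length cols_nth nth_mem)
      then have "col ?B b \<in> set (concat (map (\<lambda>k. cols (?H * X ^\<^sub>m k * ?U)) [0..<dim_row X]))"
        using k X by auto
      moreover have "set (cols (?H * X ^\<^sub>m k * ?U)) \<subseteq> carrier_vec p" for k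
        using cols_dim[of "?H * X ^\<^sub>m k * ?U"] p by simp
      then have "set (concat (map (\<lambda>k. cols (?H * X ^\<^sub>m k * ?U)) [0..<dim_row X])) \<subseteq> carrier_vec p"
        by auto
      ultimately have "col ?B b \<in> set (cols ?O)"
        unfolding output_ctrb_mat_def p by (subst cols_mat_of_cols) auto
      then have "0 = z \<bullet> col ?B b"
        using orth by simp
      also have "\<dots> = (\<Sum>a<p. z $ a * ?B $$ (a, b))"
        using B b z unfolding scalar_prod_def
        by (intro sum.cong) (auto simp del: index_mult_mat)
      also have "\<dots> = (\<Sum>a<p. \<eta> (t a) * (X ^\<^sub>m k) $$ (t a, j))"
      proof (intro sum.cong refl)
        fix a assume "a \<in> {..<p}"
        then have a: "a < card VT" "a < p" by (auto simp: p_def)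
        show "z $ a * ?B $$ (a, b) = \<eta> (t a) * (X ^\<^sub>m k) $$ (t a, j)"
          using index_sel_mat_mult[OF pow_carrier_mat[OF X] VL VT a(1) b(1)] \<eta>[OF a(2)] b(2)
          by (simp only: t_def)
      qed
      also have "\<dots> = (\<Sum>i\<in>VT. \<eta> i * (X ^\<^sub>m k) $$ (i, j))"
        by (rule sum.reindex_bij_betw[OF t])
      finally show ?thesis by simp
    qed
    then have "\<eta> i = 0" if "i \<in> VT" for i
      using triv that by blast
    then have "z $ a = 0" if "a < p" for a
      using \<eta>[OF that] t that by (metis bij_betwE lessThan_iff)
    then show "z = 0\<^sub>v p"
      using z by auto
  qed
  then show ?thesis
    unfolding output_controllable_def p .
qed

section \<open>Induction along the forcing process\<close>

text \<open>When \<open>u\<close> forces \<open>v\<close>, \<open>u\<close> and all its other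
  out-neighbours are already black, so \<open>P\<close> is available for them. The rule hides the
  order of the changes and serves both \<open>G\<close> and the layer graphs.\<close>

lemma (in pair_fin_digraph) derived_set_induct [consumes 2, case_names base force]:
  assumes C: "C \<subseteq> pverts G" and x: "x \<in> derived_set G C"
    and base: "\<And>v. v \<in> C \<Longrightarrow> P v"
    and force: "\<And>u v. P u \<Longrightarrow> (u, v) \<in> parcs G \<Longrightarrow>
      (\<And>w. (u, w) \<in> parcs G \<Longrightarrow> w \<noteq> v \<Longrightarrow> P w) \<Longrightarrow> P v"
  shows "P x"
proof -
  have "(color_change G)\<^sup>*\<^sup>* C (derived_set G C)"
    using theI'[OF derived_set_ex1[OF C]] by (simp add: derived_set_def)
  then have "\<forall>v\<in>derived_set G C. P v"
  proof (induction rule: rtranclp_induct)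
    case base
    then show ?case using assms(3) by blast
  next
    case (step A B)
    then obtain u v where uv: "u \<in> A" "{w. (u, w) \<in> parcs G \<and> w \<notin> A} = {v}" "B = insert v A"
      by (auto simp: color_change_def)
    have "P v"
    proof (rule force)
      show "P u" using uv step.IH by blast
      show "(u, v) \<in> parcs G" using uv by blast
      show "P w" if "(u, w) \<in> parcs G" "w \<noteq> v" for w using that uv step.IH by blast
    qed
    then show ?case using uv step.IH by blast
  qed
  then show ?thesis using x by blast
qed

lemma (in pair_fin_digraph) derived_set_subset:
  assumes "C \<subseteq> pverts G"
  shows "derived_set G C \<subseteq> pverts G"
proof
  fix x assume "x \<in> derived_set G C"
  with assms show "x \<in> pverts G"
    by (induction rule: derived_set_induct) (use assms in \<open>auto dest: in_arcsD2\<close>)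
qed

section \<open>Distances and the support of matrix powers\<close>

lemma (in wf_digraph) apath_suffix_from:
  assumes "apath u p w" "v \<in> set (awalk_verts u p)"
  obtains q where "apath v q w" "length q \<le> length p"
  using assms
proof (induction p arbitrary: u thesis)
  case Nil
  then show ?case by (auto simp: apath_simps)
next
  case (Cons e p)
  show ?case
  proof (cases "v = u")
    case True
    then show ?thesis using Cons.prems by blast
  next
    case False
    then have "apath (head G e) p w" "v \<in> set (awalk_verts (head G e) p)"
      using Cons.prems by (auto simp: apath_simps)
    then show ?thesis
      using Cons.IH Cons.prems(1) by (metis le_SucI length_Cons)
  qed
qed

context pair_wf_digraph
begin

text \<open>The infimum of a nonempty family in \<open>enat\<close> is attained, and a finite bound
  excludes the empty family.\<close>

lemma gdist_le_iff: "gdist G u v \<le> enat k \<longleftrightarrow> (\<exists>p. apath u p v \<and> length p \<le> k)"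
proof
  assume le: "gdist G u v \<le> enat k"
  let ?S = "(\<lambda>p. enat (length p)) ` {p. apath u p v}"
  have "?S \<noteq> {}"
    using le by (cases "{p. apath u p v} = {}") (simp_all add: gdist_def top_enat_def)
  then have "Inf ?S \<in> ?S"
    by (auto simp: Inf_enat_def intro: LeastI)
  then show "\<exists>p. apath u p v \<and> length p \<le> k"
    using le by (auto simp: gdist_def)
next
  assume "\<exists>p. apath u p v \<and> length p \<le> k"
  then obtain p where "apath u p v" "length p \<le> k" by blast
  then show "gdist G u v \<le> enat k"
    unfolding gdist_def by (intro INF_lower2[of p]) auto
qed

text \<open>Paths repeat no vertex, so the arc can be put in front only if \<open>u\<close> is not
  yet on the path; otherwise the suffix from \<open>u\<close> is itself short enough.\<close>

lemma gdist_le_Suc: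
  assumes "(u, v) \<in> parcs G" "gdist G v w \<le> enat k"
  shows "gdist G u w \<le> enat (Suc k)"
proof -
  obtain p where p: "apath v p w" "length p \<le> k"
    using assms(2) gdist_le_iff by blast
  show ?thesis
  proof (cases "u \<in> set (awalk_verts v p)")
    case True
    then obtain q where "apath u q w" "length q \<le> length p"
      using apath_suffix_from[OF p(1)] by blast
    then show ?thesis
      using p(2) by (auto simp: gdist_le_iff intro!: exI[of _ q])
  next
    case False
    then have "apath u ((u, v) # p) w"
      using assms(1) p(1) by (simp add: apath_Cons_iff)
    then show ?thesis
      using p(2) by (auto simp: gdist_le_iff intro!: exI[of _ "(u, v) # p"])
  qed
qed

end

lemma index_pow_mat_Suc:
  assumes "X \<in> carrier_mat n n" "i < n" "j < n"
  shows "(X ^\<^sub>m Suc k) $$ (i, j) = (\<Sum>l<n. (X ^\<^sub>m k) $$ (i, l) * X $$ (l, j))"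
  using assms by (simp add: scalar_prod_def atLeast0LessThan)

text \<open>A nonzero entry of the power needs a walk of \<open>k\<close> steps, each along an arc
  or staying in place, as diagonal entries of \<open>X\<close> may be nonzero. Hence only an upper
  bound on the distance.\<close>

lemma gdist_le_if_pow_mat_nonzero:
  assumes "pair_wf_digraph G" and V: "pverts G = {..<n}" and X: "X \<in> qual_class G"
    and ij: "i < n" "j < n" and "(X ^\<^sub>m k) $$ (i, j) \<noteq> 0"
  shows "gdist G j i \<le> enat k"
proof -
  interpret pair_wf_digraph G by fact
  have XC: "X \<in> carrier_mat n n"
    and arc: "\<And>i j. i < n \<Longrightarrow> j < n \<Longrightarrow> i \<noteq> j \<Longrightarrow> X $$ (i, j) \<noteq> 0 \<Longrightarrow> (j, i) \<in> parcs G"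
    using X V by (auto simp: qual_class_def)
  show ?thesis
    using assms(6) ij(2)
  proof (induction k arbitrary: j)
    case 0
    then have "i = j"
      using XC ij by (auto split: if_splits)
    then show ?case
      using ij V by (auto simp: gdist_le_iff apath_Nil_iff)
  next
    case (Suc k)
    then have "(\<Sum>l<n. (X ^\<^sub>m k) $$ (i, l) * X $$ (l, j)) \<noteq> 0"
      using index_pow_mat_Suc[OF XC ij(1)] by metis
    then obtain l where l: "l < n" "(X ^\<^sub>m k) $$ (i, l) \<noteq> 0" "X $$ (l, j) \<noteq> 0"
      by (metis (no_types, lifting) lessThan_iff mult_eq_0_iff sum.neutral)
    have le: "gdist G l i \<le> enat k"
      using Suc.IH l by blast
    show ?case
    proof (cases "l = j")
      case True
      then show ?thesis
        using le by (meson enat_ord_simps(1) le_SucI order.refl order_trans)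
    next
      case False
      then show ?thesis
        using arc[of l j] l Suc.prems le by (intro gdist_le_Suc) auto
    qed
  qed
qed

section \<open>From forcing in the graph and its layers to the vanishing of \<eta>\<close>

theorem theorem4:
  fixes G :: "nat pair_pre_digraph" and n d :: nat
    and VL VT :: "nat set" and Vp :: "nat \<Rightarrow> nat set"
  assumes "pair_digraph G"
    and "pverts G = {..<n}"
    and "VL \<subseteq> pverts G"
    and "VT \<subseteq> pverts G"
    and "VT - derived_set G VL = (\<Union>i\<in>{1..d}. Vp i)"
    and "\<forall>j \<in> VT - derived_set G VL. \<forall>i\<in>{1..d}.
           j \<in> Vp i \<longleftrightarrow> gdist_set G (derived_set G VL) j = enat i"
    and "\<forall>i\<in>{1..d}. zero_forcing_set (layer_graph G (derived_set G VL) i (Vp i)) (derived_set G VL)"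
  shows "targeted_controllable G VL VT (qual_class_d G)"
proof -
  interpret pair_digraph G by fact
  define D where "D = derived_set G VL"
  have D: "D \<subseteq> {..<n}"
    unfolding D_def using derived_set_subset assms(2,3) by metis
  have card: "card (pverts G) = n"
    using assms(2) by simp
  have layer: "gdist_set G D i = enat m" "i \<in> VT - D" if "i \<in> Vp m" "m \<in> {1..d}" for i m
    using that assms(5,6) unfolding D_def by blast+
  show ?thesis
    unfolding targeted_controllable_def card
  proof (intro ballI output_controllable_sel_matI)
    fix X assume "X \<in> qual_class_d G"
    then have XQ: "X \<in> qual_class G" and dip: "distance_info_preserving G X"
      by (auto simp: qual_class_d_def)
    then show X: "X \<in> carrier_mat n n"
      by (simp add: qual_class_def card)
    have arc: "X $$ (i, j) \<noteq> 0 \<longleftrightarrow> (j, i) \<in> parcs G" if "i < n" "j < n" "i \<noteq> j" for i j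
      using XQ that assms(2) by (simp add: qual_class_def)
    show VL: "VL \<subseteq> {..<n}" and VT: "VT \<subseteq> {..<n}"
      using assms(2-4) by auto
    fix \<eta> t
    assume ctrb: "\<forall>k<n. \<forall>j\<in>VL. (\<Sum>i\<in>VT. \<eta> i * (X ^\<^sub>m k) $$ (i, j)) = 0" and t: "t \<in> VT"
    have finVT: "finite VT"
      using VT finite_subset by auto
    \<comment> \<open>Entry \<open>j\<close> of the row vector \<eta> times
      \<open>X ^\<^sub>m k\<close>, with \<eta> extended by zero outside \<open>VT\<close>.\<close>
    define s where "s k j = (\<Sum>i\<in>VT. \<eta> i * (X ^\<^sub>m k) $$ (i, j))" for k j
    have rec: "s (Suc k) j = (\<Sum>l<n. s k l * X $$ (l, j))" if "j < n" for k j
    proof -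
      have "s (Suc k) j = (\<Sum>i\<in>VT. \<Sum>l<n. \<eta> i * (X ^\<^sub>m k) $$ (i, l) * X $$ (l, j))"
        unfolding s_def
      proof (intro sum.cong refl)
        fix i assume "i \<in> VT"
        then have "i < n" using VT by blast
        then show "\<eta> i * (X ^\<^sub>m Suc k) $$ (i, j) =
            (\<Sum>l<n. \<eta> i * (X ^\<^sub>m k) $$ (i, l) * X $$ (l, j))"
          by (simp only: index_pow_mat_Suc[OF X _ that] sum_distrib_left mult.assoc)
      qed
      also have "\<dots> = (\<Sum>l<n. s k l * X $$ (l, j))"
        by (subst sum.swap) (simp add: s_def sum_distrib_right)
      finally show ?thesis .
    qed
    \<comment> \<open>The rank condition covers only \<open>k < n\<close>; the recurrence gives all
      \<open>k\<close>, as required by forces, each of which lowers the exponent by one.\<close>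
    have s_VL: "s k j = 0" if "j \<in> VL" for k j
    proof (rule linear_recurrence_vanishes[where n = n and M = "\<lambda>l j. X $$ (l, j)"])
      show "j < n" using that VL by blast
      show "s k j = 0" if "k < n" for k
        using that \<open>j \<in> VL\<close> ctrb by (simp add: s_def)
    qed (rule rec)
    have s_D: "\<forall>k. s k j = 0" if "j \<in> D" for j
      using assms(3) that unfolding D_def
    proof (induction rule: derived_set_induct)
      case (base v)
      then show ?case using s_VL by blast
    next
      case (force u v)
      have uv: "u < n" "v < n" "u \<noteq> v"
        using force.hyps in_arcsD1[of u v] in_arcsD2[of u v] no_loops[of "(u, v)"] assms(2) by auto
      have "s k v = 0" for k
      proof -
        \<comment> \<open>The term of \<open>u\<close> vanishes by induction whatever the diagonal
          entry is, those of its out-neighbours other than \<open>v\<close> by induction, the rest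
          because \<open>X\<close> is zero there.\<close>
        have "0 = (\<Sum>l<n. s k l * X $$ (l, u))"
          using force.IH(1) rec[OF uv(1)] by metis
        also have "\<dots> = (\<Sum>l\<in>{v}. s k l * X $$ (l, u))"
        proof (intro sum.mono_neutral_right ballI)
          fix l assume l: "l \<in> {..<n} - {v}"
          show "s k l * X $$ (l, u) = 0"
            using force.IH(1) force.IH(2)[of l] arc[of l u] l uv(1) by (cases "l = u") auto
        qed (use uv in auto)
        finally show ?thesis
          using arc[of v u] uv force.hyps by simp
      qed
      then show ?case by blast
    qed
    have \<eta>_D: "\<eta> i = 0" if "i \<in> VT" "i \<in> D" for i
    proof -
      have "0 = (\<Sum>i'\<in>VT. \<eta> i' * (X ^\<^sub>m 0) $$ (i', i))"
        using s_D[OF that(2)] unfolding s_def by metis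
      also have "\<dots> = (\<Sum>i'\<in>VT. if i' = i then \<eta> i' else 0)"
        using subsetD[OF VT] that X by (intro sum.cong) auto
      finally show ?thesis
        using that finVT by simp
    qed
    have \<eta>_layer: "\<eta> i = 0" if "m \<in> {1..d}" "i \<in> Vp m" for m i
      using that
    proof (induction m arbitrary: i rule: less_induct)
      case (less m)
      define L where "L = layer_graph G D m (Vp m)"
      have Vp: "Vp m \<subseteq> VT - D"
        using layer less.prems(1) by blast
      interpret L: pair_fin_digraph L
      proof
        have "pverts L \<subseteq> {..<n}" "parcs L \<subseteq> {..<n} \<times> {..<n}"
          using D VT Vp by (auto simp: L_def layer_graph_def)
        then show "finite (pverts L)" "finite (parcs L)"
          by (auto intro: finite_subset)
      qed (auto simp: L_def layer_graph_def)
      have D_L: "D \<subseteq> pverts L" and "derived_set L D = pverts L"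
        using assms(7) less.prems(1) by (auto simp: L_def D_def zero_forcing_set_def)
      then have "i \<in> derived_set L D"
        using less.prems(2) by (auto simp: L_def layer_graph_def)
      \<comment> \<open>Restricting the claim to \<open>Vp m\<close> is necessary: nothing is known
        of \<eta> on vertices of \<open>D\<close> outside \<open>VT\<close>. Initially black
        vertices satisfy it vacuously.\<close>
      with D_L have "i \<in> Vp m \<longrightarrow> \<eta> i = 0"
      proof (induction rule: L.derived_set_induct)
        case (base v)
        then show ?case using Vp by blast
      next
        case (force u v)
        have uv: "u \<in> D" "v \<in> Vp m" "gdist G u v = enat m"
          using force.hyps by (auto simp: L_def layer_graph_def)
        then have "u < n" "v < n" "u \<noteq> v"
          using D VT Vp by auto
        have "0 = (\<Sum>i\<in>VT. \<eta> i * (X ^\<^sub>m m) $$ (i, u))"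
          using s_D[OF uv(1)] by (simp add: s_def)
        also have "\<dots> = (\<Sum>i\<in>{v}. \<eta> i * (X ^\<^sub>m m) $$ (i, u))"
        proof (intro sum.mono_neutral_right ballI)
          fix i assume i: "i \<in> VT - {v}"
          show "\<eta> i * (X ^\<^sub>m m) $$ (i, u) = 0"
          proof (rule ccontr)
            assume "\<eta> i * (X ^\<^sub>m m) $$ (i, u) \<noteq> 0"
            then have \<eta>i: "\<eta> i \<noteq> 0" and Xi: "(X ^\<^sub>m m) $$ (i, u) \<noteq> 0"
              by auto
            \<comment> \<open>Since \<eta> vanishes on targets in \<open>D\<close>, \<open>i\<close>
              lies in some layer; the induction over layers excludes those before
              \<open>m\<close>.\<close>
            obtain m' where m': "m' \<in> {1..d}" "i \<in> Vp m'"
              using \<eta>_D \<eta>i i assms(5) unfolding D_def by blast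
            have "m \<le> m'"
              using less.IH[of m'] m' \<eta>i by force
            moreover have "gdist G u i \<le> enat m"
              using Xi XQ i VT \<open>u < n\<close> assms(2) pair_wf_digraph_axioms
              by (intro gdist_le_if_pow_mat_nonzero[of G n X]) auto
            moreover have "enat m' \<le> gdist G u i"
              using layer(1)[OF m'(2,1)] uv(1) unfolding gdist_set_def by (metis INF_lower)
            \<comment> \<open>The distance from \<open>u\<close> to \<open>i\<close> is squeezed
              between \<open>m'\<close> and \<open>m\<close>. So \<open>i\<close> is an
              out-neighbour of \<open>u\<close> in \<open>L\<close> other than \<open>v\<close>,
              where \<eta> is already zero.\<close>
            ultimately have "m' = m" "gdist G u i = enat m"
              by (metis enat_ord_simps(1) order_antisym order_trans)+
            then have "(u, i) \<in> parcs L" "i \<in> Vp m"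
              using uv(1) m' by (auto simp: L_def layer_graph_def)
            then show False
              using force.IH(2) i \<eta>i by blast
          qed
        qed (use finVT uv Vp in auto)
        finally have "\<eta> v * (X ^\<^sub>m m) $$ (v, u) = 0"
          by simp
        \<comment> \<open>Distance-information preservation enters here: an arc of \<open>L\<close>
          means distance exactly \<open>m\<close>.\<close>
        moreover have "(X ^\<^sub>m m) $$ (v, u) \<noteq> 0"
          using dip uv(3) \<open>u < n\<close> \<open>v < n\<close> \<open>u \<noteq> v\<close> assms(2)
          by (auto simp: distance_info_preserving_def)
        ultimately show ?case by simp
      qed
      then show ?case using less.prems(2) by blast
    qed
    show "\<eta> t = 0"
      using t \<eta>_D \<eta>_layer assms(5) unfolding D_def by blast
  qed
qed

end
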